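(* A matrix $D\in M_n(\mathbb{R}_{\max})$ is max-doubly stochastic if and only if $D$ is max-unital preserving and max-trace preserving.
   Context: Max algebra: $\mathbb{R}_{\max}$ denotes the semiring $(\mathbb{R}_{\ge 0},\oplus,\otimes)$ with $a\oplus b=\max(a,b)$ and $a\otimes b=ab$. $\mathbb{R}_{\max}^n$ is the set of column vectors of length $n$ with entries in $\mathbb{R}_{\ge0}$, and $M_n(\mathbb{R}_{\max})$ is the set of $n\times n$ matrices with entries in $\mathbb{R}_{\ge 0}$. The matrix product is $(A\otimes B)_{i,j}=\max_k a_{i,k}b_{k,j}$ (likewise for matrix-vector products). Let $\mathbf{1}=(1,\dots,1)^T\in\mathbb{R}_{\max}^n$. A matrix $D\in M_n(\mathbb{R}_{\max})$ is max-doubly stochastic if $D\otimes\mathbf{1}=\mathbf{1}$ and $\mathbf{1}^T\otimes D=\mathbf{1}^T$. For $x\in\mathbb{R}_{\max}^n$ put $\mathrm{tr}(x)=\max_{1\le i\le n}x_i$. A matrix $A\in M_n(\mathbb{R}_{\max})$ is max-trace preserving if $\mathrm{tr}(A\otimes x)=\mathrm{tr}(x)$ for all $x\in\mathbb{R}_{\max}^n$, and max-unital preserving if $A\otimes\mathbf{1}=\mathbf{1}$. *)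

theory Defs
  imports "HOL-Analysis.Finite_Cartesian_Product"
begin

text \<open>
  The max algebra is carried by the nonnegative reals inside \<^typ>\<open>real\<close>, with
  maximum as addition and ordinary multiplication; vectors and matrices over it are
  the entrywise nonnegative elements of \<^typ>\<open>real ^ 'n\<close> and \<^typ>\<open>real ^ 'n ^ 'm\<close>.
  As in \<^term>\<open>A $ i $ j\<close>, the first index of a matrix is the row.
\<close>

definition max_vectors :: "(real ^ 'n) set" where
  "max_vectors = {x. \<forall>i. 0 \<le> x $ i}"

definition max_matrices :: "(real ^ 'n ^ 'm) set" where
  "max_matrices = {A. \<forall>i j. 0 \<le> A $ i $ j}"

definition max_ones :: "real ^ 'n" where
  "max_ones = (\<chi> i. 1)"

definition max_matrix_vector_mult :: "real ^ 'n ^ 'm \<Rightarrow> real ^ 'n \<Rightarrow> real ^ 'm"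
    (infixl "\<otimes>v" 70) where
  "A \<otimes>v x = (\<chi> i. Max (range (\<lambda>k. A $ i $ k * x $ k)))"

text \<open>
  Product of a row vector with a matrix. Row and column vectors share one type,
  so transposes of vectors are left implicit.
\<close>

definition max_vector_matrix_mult :: "real ^ 'm \<Rightarrow> real ^ 'n ^ 'm \<Rightarrow> real ^ 'n"
    (infixl "v\<otimes>" 70) where
  "x v\<otimes> A = (\<chi> j. Max (range (\<lambda>k. x $ k * A $ k $ j)))"

definition max_doubly_stochastic :: "real ^ 'n ^ 'n \<Rightarrow> bool" where
  "max_doubly_stochastic D \<longleftrightarrow> D \<otimes>v max_ones = max_ones \<and> max_ones v\<otimes> D = max_ones"

definition max_trace :: "real ^ 'n \<Rightarrow> real" where
  "max_trace x = Max (range (\<lambda>i. x $ i))"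

definition max_trace_preserving :: "real ^ 'n ^ 'n \<Rightarrow> bool" where
  "max_trace_preserving A \<longleftrightarrow> (\<forall>x\<in>max_vectors. max_trace (A \<otimes>v x) = max_trace x)"

definition max_unital_preserving :: "real ^ 'n ^ 'n \<Rightarrow> bool" where
  "max_unital_preserving A \<longleftrightarrow> A \<otimes>v max_ones = max_ones"

end

theory Submission
  imports Defs
begin

text \<open>
  The max-trace of a product only sees the column maxima of the matrix: interchanging the two
  maxima over rows and columns gives
  \<open>tr (A \<otimes> x) = max\<^sub>k c\<^sub>k x\<^sub>k\<close>, where \<open>c = 1\<^sup>T \<otimes> A\<close>
  (lemma \<open>max_trace_mult\<close>; this is associativity of the product \<open>1\<^sup>T \<otimes> A \<otimes> x\<close>).
  If \<open>c\<close> is the all-ones vector, the right-hand side is \<open>tr x\<close>, so the trace is preserved.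
  Conversely, evaluating at the \<open>j\<close>-th unit vector isolates \<open>c\<^sub>j\<close> on the right
  and gives trace 1, so trace preservation forces every \<open>c\<^sub>j\<close> to be 1. Thus trace preservation
  is the condition on column maxima, while unitality is literally the condition on row maxima.
\<close>

lemma Max_range_commute:
  fixes f :: "'a::finite \<Rightarrow> 'b::finite \<Rightarrow> 'c::linorder"
  shows "Max (range (\<lambda>i. Max (range (\<lambda>k. f i k)))) = Max (range (\<lambda>k. Max (range (\<lambda>i. f i k))))"
proof -
  have iter_le: "Max (range (\<lambda>i. Max (range (g i)))) \<le> Max (range (\<lambda>k. Max (range (\<lambda>i. g i k))))"
    for g :: "'d::finite \<Rightarrow> 'e::finite \<Rightarrow> 'c"
  proof -
    have "g i k \<le> Max (range (\<lambda>k. Max (range (\<lambda>i. g i k))))" for i k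
    proof -
      have "g i k \<le> Max (range (\<lambda>i. g i k))" by (rule Max_ge) auto
      also have "\<dots> \<le> Max (range (\<lambda>k. Max (range (\<lambda>i. g i k))))" by (rule Max_ge) auto
      finally show ?thesis .
    qed
    then show ?thesis by simp
  qed
  show ?thesis by (intro antisym iter_le)
qed

text \<open>
  Multiplication by a nonnegative scalar is monotone and so distributes over a maximum; in the trace
  formula below, the scalar is an entry of the vector.
\<close>

lemma Max_range_mult_right:
  fixes f :: "'a::finite \<Rightarrow> real"
  assumes "0 \<le> c"
  shows "Max (range (\<lambda>i. f i * c)) = Max (range f) * c"
proof -
  have "mono (\<lambda>y. y * c)" using assms by (intro monoI mult_right_mono)
  then have "Max (range f) * c = Max ((\<lambda>y. y * c) ` range f)"
    by (rule mono_Max_commute) auto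
  then show ?thesis by (simp add: image_image)
qed

lemma max_ones_vector_mult_nth: "(max_ones v\<otimes> A) $ j = Max (range (\<lambda>i. A $ i $ j))"
  by (simp add: max_vector_matrix_mult_def max_ones_def)

lemma max_trace_mult:
  fixes A :: "real ^ 'n ^ 'm"
  assumes "x \<in> max_vectors"
  shows "max_trace (A \<otimes>v x) = Max (range (\<lambda>k. (max_ones v\<otimes> A) $ k * x $ k))"
proof -
  have "max_trace (A \<otimes>v x) = Max (range (\<lambda>k. Max (range (\<lambda>i. A $ i $ k * x $ k))))"
    unfolding max_trace_def max_matrix_vector_mult_def vec_lambda_beta
    by (rule Max_range_commute)
  also have "\<dots> = Max (range (\<lambda>k. (max_ones v\<otimes> A) $ k * x $ k))"
  proof -
    have "0 \<le> x $ k" for k using assms by (simp add: max_vectors_def)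
    then show ?thesis unfolding max_ones_vector_mult_nth by (subst Max_range_mult_right) auto
  qed
  finally show ?thesis .
qed

text \<open>
  Nonnegativity of the selected weight makes it dominate the zeros coming from the other
  coordinates of the unit vector.
\<close>

lemma Max_range_mult_axis:
  fixes c :: "'n::finite \<Rightarrow> real"
  assumes "0 \<le> c j"
  shows "Max (range (\<lambda>k. c k * axis j 1 $ k)) = c j"
proof (rule Max_eqI)
  show "c j \<in> range (\<lambda>k. c k * axis j 1 $ k)"
    by (rule range_eqI[where x = j]) (simp add: axis_def)
qed (use assms in \<open>auto simp: axis_def\<close>)

lemma max_trace_axis: "max_trace (axis j 1) = 1"
  using Max_range_mult_axis[of "\<lambda>_. 1" j] by (simp add: max_trace_def)

lemma max_trace_preserving_iff_column_maxima:
  fixes A :: "real ^ 'n ^ 'n"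
  assumes "A \<in> max_matrices"
  shows "max_trace_preserving A \<longleftrightarrow> max_ones v\<otimes> A = max_ones"
proof
  assume "max_ones v\<otimes> A = max_ones"
  then show "max_trace_preserving A"
    unfolding max_trace_preserving_def
    by (simp add: max_trace_mult) (simp add: max_ones_def max_trace_def)
next
  assume pres: "max_trace_preserving A"
  have "(max_ones v\<otimes> A) $ j = 1" for j
  proof -
    have unit: "axis j 1 \<in> max_vectors" by (simp add: max_vectors_def axis_def)
    have "0 \<le> A $ j $ j" using assms by (simp add: max_matrices_def)
    also have "\<dots> \<le> (max_ones v\<otimes> A) $ j"
      unfolding max_ones_vector_mult_nth by (rule Max_ge) auto
    finally have "(max_ones v\<otimes> A) $ j = max_trace (A \<otimes>v axis j 1)"
      using Max_range_mult_axis[of "\<lambda>k. (max_ones v\<otimes> A) $ k" j] max_trace_mult[OF unit, of A]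
      by simp
    also have "\<dots> = 1"
      using pres unit by (simp add: max_trace_preserving_def max_trace_axis)
    finally show ?thesis .
  qed
  then show "max_ones v\<otimes> A = max_ones" by (simp add: vec_eq_iff max_ones_def)
qed

theorem theorem2p6:
  fixes D :: "real ^ 'n ^ 'n"
  assumes "D \<in> max_matrices"
  shows "max_doubly_stochastic D \<longleftrightarrow> max_unital_preserving D \<and> max_trace_preserving D"
  using max_trace_preserving_iff_column_maxima[OF assms]
  by (simp add: max_doubly_stochastic_def max_unital_preserving_def)

end
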